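(* Let $X$ be a metric space, let $L_0,L_1:SM(X)\to SM(X)$ be the transfer operators of two dynamical systems on $X$, and let $B_s\subseteq B_w\subseteq SM(X)$ be two normed vector spaces of signed measures, with norms $\|\cdot\|_s$ and $\|\cdot\|_w$ satisfying $\|\cdot\|_w\le\|\cdot\|_s$ on $B_s$, such that $L_i(B_s)\subset B_s$ and $L_i(B_w)\subset B_w$ for $i\in\{0,1\}$. Let $f_0,f_1\in B_s$ be probability measures with $L_0f_0=f_0$ and $L_1f_1=f_1$. Suppose that: 1. (speed of convergence to equilibrium) there is $\phi\in C^0(\mathbb{R})$, with $\phi(t)$ decreasing to $0$ as $t\to\infty$, such that $L_0$ has convergence to equilibrium with respect to the norms $\|\cdot\|_w,\|\cdot\|_s$ and speed $\phi$; 2. (control on the norms of the invariant measures) there is $M\ge 0$ such that $\max(\|f_1\|_s,\|f_0\|_s)\le M$; 3. (iterates of the transfer operator are bounded for the weak norm) there is $\tilde C\ge 0$ such that $\|L_0^n\|_{B_w\to B_w}\le\tilde C$ for each $n\geq 0$; 4. (control on the size of the perturbation in the strong-weak norm) $\epsilon:=\sup_{f\in B_s,\ \|f\|_s\le 1}\|(L_1-L_0)f\|_w$, with $0<\epsilon<\infty$. Let $\psi$ be the decreasing function $\psi(x)=\frac{\phi(x)}{x}$ on $(0,\infty)$, with inverse $\psi^{-1}$. Then $$\|f_1-f_0\|_w\le (2M+M\tilde C)\,\epsilon\,(\psi^{-1}(\epsilon)+1).$$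
   Context: $SM(X)$ denotes the space of Borel measures with sign (signed measures) on $X$. For a dynamical system $(X,T)$ the transfer operator $L:SM(X)\to SM(X)$ is the linear map $L[\nu](B)=\nu(T^{-1}(B))$ for every measurable set $B$. Let $V_s:=\{f\in B_s: f(X)=0\}$ be the space of zero average measures in $B_s$. For $\phi$ converging to zero, $L_0$ has convergence to equilibrium with respect to the norms $\|\cdot\|_w,\|\cdot\|_s$ and speed $\phi$ if for all $g\in V_s$ and all integers $n\ge1$, $\|L_0^n(g)\|_w\le\phi(n)\|g\|_s$. Here "decreasing" is meant strictly, so that $\phi>0$ and $\psi:(0,\infty)\to(0,\infty)$ is a decreasing bijection. *)

theory Defs
  imports "HOL-Analysis.Analysis"
begin

text \<open>
  Finite signed Borel measures. So that equality of signed measures is equality on Borel sets,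
  the representing set function is normalised to vanish on non-Borel sets.
\<close>

typedef (overloaded) 'a signed_measure =
  "{\<nu> :: 'a::topological_space set \<Rightarrow> real.
     \<nu> {} = 0 \<and>
     (\<forall>A. range A \<subseteq> sets borel \<longrightarrow> disjoint_family A \<longrightarrow> (\<lambda>n::nat. \<nu> (A n)) sums \<nu> (\<Union>n. A n)) \<and>
     (\<forall>B. B \<notin> sets borel \<longrightarrow> \<nu> B = 0)}"
  morphisms smeasure Abs_signed_measure
  by (rule exI[where x = "\<lambda>_. 0"]) simp

setup_lifting type_definition_signed_measure

instantiation signed_measure :: (topological_space) real_vector
begin

lift_definition zero_signed_measure :: "'a signed_measure" is "\<lambda>_. 0"
  by simp

lift_definition plus_signed_measure ::
    "'a signed_measure \<Rightarrow> 'a signed_measure \<Rightarrow> 'a signed_measure"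
  is "\<lambda>\<mu> \<nu> B. \<mu> B + \<nu> B"
  by (auto intro: sums_add)

lift_definition minus_signed_measure ::
    "'a signed_measure \<Rightarrow> 'a signed_measure \<Rightarrow> 'a signed_measure"
  is "\<lambda>\<mu> \<nu> B. \<mu> B - \<nu> B"
  by (auto intro: sums_diff)

lift_definition uminus_signed_measure :: "'a signed_measure \<Rightarrow> 'a signed_measure"
  is "\<lambda>\<nu> B. - \<nu> B"
  by (auto intro: sums_minus)

lift_definition scaleR_signed_measure :: "real \<Rightarrow> 'a signed_measure \<Rightarrow> 'a signed_measure"
  is "\<lambda>c \<nu> B. c * \<nu> B"
  by (auto intro: sums_mult)

instance
  by standard (transfer; simp add: fun_eq_iff algebra_simps)+

end

definition probability :: "'a::topological_space signed_measure \<Rightarrow> bool" where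
  "probability \<nu> \<longleftrightarrow> (\<forall>B\<in>sets borel. 0 \<le> smeasure \<nu> B) \<and> smeasure \<nu> UNIV = 1"

text \<open>The value for a non-measurable map \<open>T\<close> is a dummy.\<close>

lift_definition transfer_operator ::
    "('a::topological_space \<Rightarrow> 'a) \<Rightarrow> 'a signed_measure \<Rightarrow> 'a signed_measure"
  is "\<lambda>T \<nu> B. if T \<in> measurable borel borel \<and> B \<in> sets borel then \<nu> (T -` B) else 0"
proof -
  fix T :: "'a \<Rightarrow> 'a" and \<nu> :: "'a set \<Rightarrow> real"
  assume \<nu>: "\<nu> {} = 0 \<and>
     (\<forall>A. range A \<subseteq> sets borel \<longrightarrow> disjoint_family A \<longrightarrow> (\<lambda>n::nat. \<nu> (A n)) sums \<nu> (\<Union>n. A n)) \<and>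
     (\<forall>B. B \<notin> sets borel \<longrightarrow> \<nu> B = 0)"
  let ?L = "\<lambda>B. if T \<in> measurable borel borel \<and> B \<in> sets borel then \<nu> (T -` B) else 0"
  have "(\<lambda>n. ?L (A n)) sums ?L (\<Union>n. A n)"
    if A: "range A \<subseteq> sets borel" "disjoint_family A" for A :: "nat \<Rightarrow> 'a set"
  proof (cases "T \<in> measurable borel borel")
    case True
    have "range (\<lambda>n. T -` A n) \<subseteq> sets borel"
      using measurable_sets[OF True] A(1) by auto
    moreover have "disjoint_family (\<lambda>n. T -` A n)"
      using A(2) by (auto simp: disjoint_family_on_def)
    ultimately have "(\<lambda>n. \<nu> (T -` A n)) sums \<nu> (\<Union>n. T -` A n)"
      using \<nu> by blast
    moreover have "(\<Union>n. A n) \<in> sets borel" "\<And>n. A n \<in> sets borel"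
      using A(1) by auto
    ultimately show ?thesis
      using True by (simp add: vimage_UN)
  qed simp
  then show "?L {} = 0 \<and>
     (\<forall>A. range A \<subseteq> sets borel \<longrightarrow> disjoint_family A \<longrightarrow> (\<lambda>n::nat. ?L (A n)) sums ?L (\<Union>n. A n)) \<and>
     (\<forall>B. B \<notin> sets borel \<longrightarrow> ?L B = 0)"
    using \<nu> by simp
qed

lemma smeasure_transfer_operator:
  assumes "T \<in> measurable borel borel" and "B \<in> sets borel"
  shows "smeasure (transfer_operator T \<nu>) B = smeasure \<nu> (T -` B)"
  using assms by transfer simp

lemma linear_transfer_operator: "linear (transfer_operator T)"
  by (rule linearI) (transfer; auto simp: fun_eq_iff)+

definition normed_subspace :: "'v::real_vector set \<Rightarrow> ('v \<Rightarrow> real) \<Rightarrow> bool" where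
  "normed_subspace V N \<longleftrightarrow> subspace V \<and>
     (\<forall>x\<in>V. 0 \<le> N x \<and> (N x = 0 \<longleftrightarrow> x = 0)) \<and>
     (\<forall>x\<in>V. \<forall>c. N (c *\<^sub>R x) = \<bar>c\<bar> * N x) \<and>
     (\<forall>x\<in>V. \<forall>y\<in>V. N (x + y) \<le> N x + N y)"

text \<open>
  Operator norm of \<open>A\<close> on \<open>V\<close> with the norm \<open>N\<close> on the domain and \<open>N'\<close> on the target;
  extended-real valued, so that it is \<open>\<infinity>\<close> for an unbounded operator.
\<close>

definition operator_norm ::
    "'v::real_vector set \<Rightarrow> ('v \<Rightarrow> real) \<Rightarrow> ('v \<Rightarrow> real) \<Rightarrow> ('v \<Rightarrow> 'v) \<Rightarrow> ereal" where
  "operator_norm V N N' A = (SUP f\<in>{f\<in>V. N f \<le> 1}. ereal (N' (A f)))"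

definition zero_average ::
    "'a::topological_space signed_measure set \<Rightarrow> 'a signed_measure set" where
  "zero_average V = {f\<in>V. smeasure f UNIV = 0}"

definition convergence_to_equilibrium ::
    "'a::topological_space signed_measure set \<Rightarrow> ('a signed_measure \<Rightarrow> real) \<Rightarrow>
     ('a signed_measure \<Rightarrow> real) \<Rightarrow> ('a signed_measure \<Rightarrow> 'a signed_measure) \<Rightarrow>
     (real \<Rightarrow> real) \<Rightarrow> bool" where
  "convergence_to_equilibrium Bs norm_w norm_s L \<phi> \<longleftrightarrow>
     (\<phi> \<longlongrightarrow> 0) at_top \<and>
     (\<forall>g\<in>zero_average Bs. \<forall>n\<ge>1. norm_w ((L ^^ n) g) \<le> \<phi> (real n) * norm_s g)"

end

theory Submission
  imports Defs
begin

text \<open>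
  For every \<open>N \<ge> 1\<close>, invariance of \<open>f0\<close> under \<open>L0\<close> gives
  \<open>f1 - f0 = L0^N (f1 - f0) + (f1 - L0^N f1)\<close>. The first summand is at most \<open>2 M \<phi>(N)\<close> by
  convergence to equilibrium. Since \<open>f1 = L1 f1\<close>, the second one telescopes into \<open>N\<close> terms
  \<open>L0^k (L1 - L0) f1\<close>, each at most \<open>M C \<epsilon>\<close>. The two bounds are balanced at
  \<open>N = \<lceil>x\<rceil>\<close>, where \<open>\<phi>(x) = \<epsilon> x\<close>.
\<close>

lemma normed_subspaceD:
  assumes "normed_subspace V N"
  shows "subspace V"
    and "x \<in> V \<Longrightarrow> 0 \<le> N x"
    and "x \<in> V \<Longrightarrow> N x = 0 \<longleftrightarrow> x = 0"
    and "x \<in> V \<Longrightarrow> N (c *\<^sub>R x) = \<bar>c\<bar> * N x"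
    and "x \<in> V \<Longrightarrow> y \<in> V \<Longrightarrow> N (x + y) \<le> N x + N y"
  using assms by (auto simp: normed_subspace_def)

lemma normed_subspace_diff_le:
  assumes V: "normed_subspace V N" and "x \<in> V" "y \<in> V"
  shows "N (x - y) \<le> N x + N y"
proof -
  have "- y \<in> V"
    using assms by (simp add: normed_subspaceD(1) subspace_neg)
  moreover have "N (- y) = N y"
    using normed_subspaceD(4)[OF V \<open>y \<in> V\<close>, of "-1"] by simp
  ultimately show ?thesis
    using normed_subspaceD(5)[OF V \<open>x \<in> V\<close>, of "- y"] by simp
qed

text \<open>Rescaling \<open>f\<close> to norm 1 puts it into the set over which the supremum is
  taken, and linearity scales the estimate back. The vector 0 cannot be rescaled and is treated
  apart.\<close>

lemma operator_norm_bound: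
  assumes V: "normed_subspace V N" and W: "normed_subspace W N'"
    and A: "linear A" "A ` V \<subseteq> W"
    and c: "operator_norm V N N' A \<le> ereal c"
    and f: "f \<in> V"
  shows "N' (A f) \<le> c * N f"
proof (cases "f = 0")
  case True
  have "0 \<in> V" "0 \<in> W"
    using V W by (simp_all add: normed_subspaceD(1) subspace_0)
  then have "N f = 0" "N' (A f) = 0"
    using True normed_subspaceD(3)[OF V] normed_subspaceD(3)[OF W] linear_0[OF A(1)] by auto
  then show ?thesis by simp
next
  case False
  then have pos: "N f > 0"
    using normed_subspaceD(2,3)[OF V f] by linarith
  let ?g = "(1 / N f) *\<^sub>R f"
  have "?g \<in> V"
    using V f by (simp add: normed_subspaceD(1) subspace_scale)
  moreover have "N ?g = 1"
    using pos normed_subspaceD(4)[OF V f, of "1 / N f"] by simp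
  ultimately have "ereal (N' (A ?g)) \<le> operator_norm V N N' A"
    unfolding operator_norm_def by (intro SUP_upper) simp
  then have "N' (A ?g) \<le> c"
    using c by (metis ereal_less_eq(3) order_trans)
  moreover have "N' (A ?g) = N' (A f) / N f"
    using pos normed_subspaceD(4)[OF W, of "A f" "1 / N f"] A f
    by (simp add: linear_cmul image_subset_iff)
  ultimately show ?thesis
    using pos by (simp add: divide_le_eq)
qed

lemma linear_funpow:
  fixes L :: "'v::real_vector \<Rightarrow> 'v"
  assumes "linear L"
  shows "linear (L ^^ n)"
proof (induction n)
  case 0
  show ?case using linear_id by (simp add: id_def)
next
  case (Suc n)
  then show ?case
    unfolding funpow.simps using assms by (rule linear_compose)
qed

lemma image_funpow_subset:
  assumes "L ` V \<subseteq> V"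
  shows "(L ^^ n) ` V \<subseteq> V"
  using assms by (induction n) auto

text \<open>The difference telescopes into the \<open>n\<close> terms
  \<open>(L ^^ k) (f - L f)\<close> with \<open>k < n\<close>, and the uniform bound
  \<open>C\<close> on the iterates applies to each of them.\<close>

lemma iterate_deviation_bound:
  assumes W: "normed_subspace W N" and L: "linear L" "L ` W \<subseteq> W"
    and bound: "\<And>n::nat. operator_norm W N N (L ^^ n) \<le> ereal C"
    and f: "f \<in> W"
  shows "N (f - (L ^^ n) f) \<le> real n * (C * N (f - L f))"
proof (induction n)
  case 0
  have "N 0 = 0"
    using W by (simp add: normed_subspaceD(1,3) subspace_0)
  then show ?case by simp
next
  case (Suc n)
  have sub: "subspace W" and lin: "linear (L ^^ n)" and inv: "(L ^^ n) ` W \<subseteq> W"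
    using W L by (simp_all add: normed_subspaceD(1) linear_funpow image_funpow_subset)
  have d: "f - L f \<in> W" "f - (L ^^ n) f \<in> W"
    using sub f L(2) inv by (auto intro!: subspace_diff)
  have "f - (L ^^ Suc n) f = (f - (L ^^ n) f) + (L ^^ n) (f - L f)"
    by (simp add: linear_diff[OF lin] funpow_swap1)
  then have "N (f - (L ^^ Suc n) f) \<le> N (f - (L ^^ n) f) + N ((L ^^ n) (f - L f))"
    using normed_subspaceD(5)[OF W d(2), of "(L ^^ n) (f - L f)"] d(1) inv
    by (metis image_subset_iff)
  also have "\<dots> \<le> real n * (C * N (f - L f)) + C * N (f - L f)"
    using Suc operator_norm_bound[OF W W lin inv bound d(1)] by linarith
  finally show ?case by (simp add: algebra_simps)
qed

text \<open>A decreasing function stays above its limit, so \<open>\<phi> (x + 1)\<close> is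
  nonnegative; strictness between \<open>x\<close> and \<open>x + 1\<close> then makes
  \<open>\<phi> x\<close> positive.\<close>

lemma strict_antimono_tendsto_0_pos:
  fixes \<phi> :: "real \<Rightarrow> real"
  assumes anti: "strict_antimono_on {0<..} \<phi>" and lim: "(\<phi> \<longlongrightarrow> 0) at_top" and "0 < x"
  shows "0 < \<phi> x"
proof -
  have dec: "\<phi> z < \<phi> y" if "0 < y" "y < z" for y z
    using anti that by (auto simp: monotone_on_def)
  have "eventually (\<lambda>t. \<phi> t \<le> \<phi> (x + 1)) at_top"
    using eventually_gt_at_top[of "x + 1"]
    by eventually_elim (use dec[of "x + 1"] \<open>0 < x\<close> in force)
  then have "0 \<le> \<phi> (x + 1)"
    using tendsto_upperbound[OF lim] by simp
  then show ?thesis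
    using dec[of x "x + 1"] \<open>0 < x\<close> by linarith
qed

text \<open>This makes \<open>the_inv_into\<close> a genuine inverse of \<psi> in the main estimate.
  Injectivity is strict monotonicity of the quotient; surjectivity is the intermediate value
  theorem.\<close>

lemma bij_betw_quotient_by_argument:
  fixes \<phi> :: "real \<Rightarrow> real"
  assumes cont: "continuous_on UNIV \<phi>"
    and anti: "strict_antimono_on {0<..} \<phi>" and lim: "(\<phi> \<longlongrightarrow> 0) at_top"
  shows "bij_betw (\<lambda>x. \<phi> x / x) {0<..} {0<..}"
proof -
  have dec: "\<phi> z < \<phi> y" if "0 < y" "y < z" for y z
    using anti that by (auto simp: monotone_on_def)
  note pos = strict_antimono_tendsto_0_pos[OF anti lim]
  have "\<phi> z / z < \<phi> y / y" if "0 < y" "y < z" for y z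
    using dec[OF that] pos[of z] that by (intro frac_less) auto
  then have inj: "inj_on (\<lambda>x. \<phi> x / x) {0<..}"
    by (intro linorder_inj_onI) (auto, metis less_irrefl)
  have "\<exists>x>0. \<phi> x / x = e" if "0 < e" for e
  proof -
    \<comment> \<open>The line \<open>e * t\<close> takes the value \<open>\<phi> 1\<close> at
      \<open>t = \<phi> 1 / e\<close>. Cutting this point off at 1 from above and from below gives
      \<open>e * a \<le> \<phi> 1 \<le> \<phi> a\<close> and
      \<open>\<phi> b \<le> \<phi> 1 \<le> e * b\<close>, hence a sign change of
      \<open>\<phi> t - e * t\<close> between \<open>a\<close> and \<open>b\<close>.\<close>
    define a where "a = min 1 (\<phi> 1 / e)"
    define b where "b = max 1 (\<phi> 1 / e)"
    have a: "0 < a" "a \<le> 1" "e * a \<le> \<phi> 1"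
      using pos[of 1] \<open>0 < e\<close> by (auto simp: a_def min_def field_simps)
    have b: "1 \<le> b" "\<phi> 1 \<le> e * b"
      using pos[of 1] \<open>0 < e\<close> by (auto simp: b_def max_def field_simps)
    have "\<phi> 1 \<le> \<phi> a" "\<phi> b \<le> \<phi> 1"
      using dec[of a 1] dec[of 1 b] a b by (auto simp: le_less)
    then have "\<phi> b - e * b \<le> 0" "0 \<le> \<phi> a - e * a"
      using a b by linarith+
    moreover have "continuous_on {a..b} (\<lambda>x. \<phi> x - e * x)"
      by (intro continuous_intros continuous_on_subset[OF cont]) auto
    ultimately obtain x where "a \<le> x" "\<phi> x - e * x = 0"
      using IVT2'[of "\<lambda>x. \<phi> x - e * x" b 0 a] a b by auto
    then show ?thesis
      using a by (intro exI[of _ x]) (auto simp: field_simps)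
  qed
  then have "(\<lambda>x. \<phi> x / x) ` {0<..} = {0<..}"
    using pos by (force simp: image_iff)
  then show ?thesis
    using inj by (simp add: bij_betw_def)
qed

theorem theorem3:
  fixes T0 T1 :: "'a::metric_space \<Rightarrow> 'a"
    and L0 L1 :: "'a signed_measure \<Rightarrow> 'a signed_measure"
    and Bs Bw :: "'a signed_measure set"
    and norm_s norm_w :: "'a signed_measure \<Rightarrow> real"
    and f0 f1 :: "'a signed_measure"
    and \<phi> :: "real \<Rightarrow> real"
    and M C \<epsilon> :: real
  assumes "T0 \<in> measurable borel borel" and "T1 \<in> measurable borel borel"
    and "L0 = transfer_operator T0" and "L1 = transfer_operator T1"
    and "normed_subspace Bs norm_s" and "normed_subspace Bw norm_w"
    and "Bs \<subseteq> Bw"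
    and "\<And>f. f \<in> Bs \<Longrightarrow> norm_w f \<le> norm_s f"
    and "L0 ` Bs \<subseteq> Bs" and "L1 ` Bs \<subseteq> Bs"
    and "L0 ` Bw \<subseteq> Bw" and "L1 ` Bw \<subseteq> Bw"
    and "f0 \<in> Bs" and "probability f0" and "L0 f0 = f0"
    and "f1 \<in> Bs" and "probability f1" and "L1 f1 = f1"
    and "continuous_on UNIV \<phi>" and "strict_antimono_on {0<..} \<phi>" and "(\<phi> \<longlongrightarrow> 0) at_top"
    and "convergence_to_equilibrium Bs norm_w norm_s L0 \<phi>"
    and "M \<ge> 0" and "max (norm_s f1) (norm_s f0) \<le> M"
    and "C \<ge> 0" and "\<And>n::nat. operator_norm Bw norm_w norm_w (L0 ^^ n) \<le> ereal C"
    and "ereal \<epsilon> = operator_norm Bs norm_s norm_w (\<lambda>f. L1 f - L0 f)" and "\<epsilon> > 0"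
  shows "norm_w (f1 - f0)
    \<le> (2 * M + M * C) * \<epsilon> * (the_inv_into {0<..} (\<lambda>x. \<phi> x / x) \<epsilon> + 1)"
proof -
  note Bs = assms(5) and Bw = assms(6) and sub = assms(7)
  have f0: "f0 \<in> Bs" "L0 f0 = f0" and f1: "f1 \<in> Bs" "L1 f1 = f1"
    using assms by auto
  have lin: "linear L0" "linear L1"
    using assms(3,4) by (simp_all add: linear_transfer_operator)
  have subspaces: "subspace Bs" "subspace Bw"
    using Bs Bw by (simp_all add: normed_subspaceD(1))
  have bounds: "norm_s f0 \<le> M" "norm_s f1 \<le> M"
    using assms(24) by auto
  define x where "x = the_inv_into {0<..} (\<lambda>x. \<phi> x / x) \<epsilon>"
  have bij: "bij_betw (\<lambda>x. \<phi> x / x) {0<..} {0<..}"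
    using bij_betw_quotient_by_argument assms(19-21) by blast
  have "x \<in> {0<..}" "\<phi> x / x = \<epsilon>"
    using bij_betw_the_inv_into[OF bij] f_the_inv_into_f_bij_betw[OF bij, of \<epsilon>] \<open>\<epsilon> > 0\<close>
    by (auto simp: x_def bij_betw_def)
  then have x: "0 < x" "\<phi> x = \<epsilon> * x"
    by (auto simp: field_simps)
  \<comment> \<open>Rounding up serves three ends: \<open>N \<ge> 1\<close>, where the speed
    estimate is available; \<open>x \<le> N\<close>, so that
    \<open>\<phi> N \<le> \<phi> x = \<epsilon> * x\<close>; and \<open>N \<le> x + 1\<close>, which
    bounds the number of telescoping terms and is the source of the \<open>+ 1\<close> in the
    result.\<close>
  define N where "N = nat \<lceil>x\<rceil>"
  have N: "1 \<le> N" "x \<le> real N" "real N \<le> x + 1"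
    using x(1) unfolding N_def by linarith+
  have "\<phi> (real N) \<le> \<phi> x"
    using assms(20) x(1) N(2) by (cases "real N = x") (auto simp: monotone_on_def le_less)
  then have \<phi>N: "\<phi> (real N) \<le> \<epsilon> * x"
    by (simp add: x)
  have \<phi>N_pos: "0 < \<phi> (real N)"
    using strict_antimono_tendsto_0_pos[OF assms(20,21)] N by simp
  have LN: "linear (L0 ^^ N)" "(L0 ^^ N) ` Bs \<subseteq> Bs"
    using lin(1) assms(9) by (simp_all add: linear_funpow image_funpow_subset)

  \<comment> \<open>Both measures have total mass 1, so the masses cancel.\<close>
  have "f1 - f0 \<in> zero_average Bs"
    using subspaces(1) f0 f1 assms(14,17)
    by (simp add: zero_average_def subspace_diff minus_signed_measure.rep_eq probability_def)
  then have "norm_w ((L0 ^^ N) (f1 - f0)) \<le> \<phi> (real N) * norm_s (f1 - f0)"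
    using assms(22) N(1) by (simp add: convergence_to_equilibrium_def)
  also have "\<dots> \<le> \<phi> (real N) * (2 * M)"
    using normed_subspace_diff_le[OF Bs f1(1) f0(1)] bounds \<phi>N_pos
    by (intro mult_left_mono) auto
  also have "\<dots> \<le> \<epsilon> * x * (2 * M)"
    using \<phi>N assms(23) by (intro mult_right_mono) auto
  finally have equilibrium: "norm_w ((L0 ^^ N) (f1 - f0)) \<le> \<epsilon> * x * (2 * M)" .

  \<comment> \<open>The perturbation is measured from the strong to the weak norm, so it is applied
    to \<open>f1\<close> itself, whose strong norm is at most \<open>M\<close>. Invariance of
    \<open>f1\<close> under \<open>L1\<close> turns the result into a bound on
    \<open>f1 - L0 f1\<close>.\<close>
  have "linear (\<lambda>f. L1 f - L0 f)" "(\<lambda>f. L1 f - L0 f) ` Bs \<subseteq> Bw"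
    using lin assms(9,10) sub subspaces(1) by (auto intro!: linear_compose_sub dest: subspace_diff)
  then have "norm_w (L1 f1 - L0 f1) \<le> \<epsilon> * norm_s f1"
    using operator_norm_bound[OF Bs Bw _ _ _ f1(1)] assms(27) by (metis order_refl)
  also have "\<dots> \<le> \<epsilon> * M"
    using bounds \<open>\<epsilon> > 0\<close> by simp
  finally have perturbation: "norm_w (f1 - L0 f1) \<le> \<epsilon> * M"
    using f1 by simp
  have "norm_w (f1 - (L0 ^^ N) f1) \<le> real N * (C * norm_w (f1 - L0 f1))"
    using iterate_deviation_bound[OF Bw lin(1) assms(11,26)] f1(1) sub by blast
  also have "\<dots> \<le> (x + 1) * (C * (\<epsilon> * M))"
    using perturbation N(3) x(1) assms(23,25) \<open>\<epsilon> > 0\<close>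
    by (intro mult_mono mult_left_mono mult_nonneg_nonneg normed_subspaceD(2)[OF Bw])
      (use sub subspaces(1) f1(1) assms(9) in \<open>auto dest: subspace_diff\<close>)
  finally have deviation: "norm_w (f1 - (L0 ^^ N) f1) \<le> (x + 1) * (C * (\<epsilon> * M))" .

  have "(L0 ^^ N) f0 = f0"
    using f0(2) by (induction N) auto
  then have "f1 - f0 = (L0 ^^ N) (f1 - f0) + (f1 - (L0 ^^ N) f1)"
    by (simp add: linear_diff[OF LN(1)])
  moreover have "(L0 ^^ N) (f1 - f0) \<in> Bw" "f1 - (L0 ^^ N) f1 \<in> Bw"
    using LN(2) sub subspaces(1) f0(1) f1(1) by (auto simp: subspace_diff image_subset_iff subset_iff)
  ultimately have "norm_w (f1 - f0)
      \<le> norm_w ((L0 ^^ N) (f1 - f0)) + norm_w (f1 - (L0 ^^ N) f1)"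
    using normed_subspaceD(5)[OF Bw] by metis
  also have "\<dots> \<le> \<epsilon> * x * (2 * M) + (x + 1) * (C * (\<epsilon> * M))"
    using equilibrium deviation by linarith
  \<comment> \<open>Enlarging \<open>x\<close> to \<open>x + 1\<close> in the equilibrium term gives
    both terms the common factor \<open>\<epsilon> * (x + 1)\<close>.\<close>
  also have "\<dots> \<le> \<epsilon> * (x + 1) * (2 * M) + (x + 1) * (C * (\<epsilon> * M))"
    using assms(23) \<open>\<epsilon> > 0\<close> by (simp add: mult_left_mono mult_right_mono)
  also have "\<dots> = (2 * M + M * C) * \<epsilon> * (x + 1)"
    by (simp add: algebra_simps)
  finally show ?thesis
    by (simp add: x_def)
qed

end
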